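(* The parameter tiling $T$ is a fixed point of the following substitution, which replaces each cell $(x,y)\in\mathbb{N}^2$ by a $4\times 4$ block depending on which of $V\times V$, $V\times D$, $D\times V$, $D\times D$ contains $(x,y)$ (with $1$ for black and $0$ for white): $$V\times V\ni(x,y)\mapsto\begin{array}{cccc}0&1&0&0\\0&1&0&0\\1&0&1&1\\0&1&0&0\end{array},\qquad V\times D\ni(x,y)\mapsto\begin{array}{cccc}0&1&0&1\\0&1&0&1\\1&0&1&0\\0&1&0&1\end{array},$$ $$D\times V\ni(x,y)\mapsto\begin{array}{cccc}1&0&1&1\\0&1&0&0\\1&0&1&1\\0&1&0&0\end{array},\qquad D\times D\ni(x,y)\mapsto\begin{array}{cccc}1&0&1&0\\0&1&0&1\\1&0&1&0\\0&1&0&1\end{array}.$$ That is, for every $(x,y)\in\mathbb{N}^2$, the restriction of $T$ to $\{4x-3,4x-2,4x-1,4x\}\times\{4y-3,4y-2,4y-1,4y\}$ is the block assigned to $(x,y)$.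
   Context: $\mathbb{N}$ denotes the positive integers. $V$ is the set of positive integers whose last non-zero digit in base $4$ is $1$ or $3$, and $D=\mathbb{N}\setminus V$. The function $c:\mathbb{N}\to\{0,1\}$ is $c(n)=1$ if $n\in V$ and $c(n)=0$ if $n\in D$. The parameter tiling $T:\mathbb{N}^2\to\{0,1\}$ is defined by $T(x,y)=1$ (black) if $c(x)\neq c(y)$ and $T(x,y)=0$ (white) if $c(x)=c(y)$. Reading convention for the displayed blocks: the rows, read from bottom to top, correspond to the first-coordinate values $4x-3,4x-2,4x-1,4x$, and the columns, read from left to right, correspond to the second-coordinate values $4y-3,4y-2,4y-1,4y$. *)

theory Defs
  imports Main
begin

text \<open>Positive integers are natural numbers \<open>n > 0\<close>; the values of the functions below
  at \<open>0\<close> play no role.\<close>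

definition digit4 :: "nat \<Rightarrow> nat \<Rightarrow> nat" where
  "digit4 n i = n div 4 ^ i mod 4"

text \<open>The last non-zero digit is the one at the least position \<open>i\<close> (position \<open>0\<close> being the
  units) carrying a non-zero digit.  Such a position exists whenever \<open>n > 0\<close>.\<close>

definition last_nonzero_digit4 :: "nat \<Rightarrow> nat" where
  "last_nonzero_digit4 n = digit4 n (LEAST i. digit4 n i \<noteq> 0)"

definition V :: "nat set" where
  "V = {n. n > 0 \<and> last_nonzero_digit4 n \<in> {1, 3}}"

definition D :: "nat set" where
  "D = {n. n > 0} - V"

definition c :: "nat \<Rightarrow> nat" where
  "c n = (if n \<in> V then 1 else 0)"

text \<open>\<open>1\<close> is black, \<open>0\<close> is white.\<close>

definition parameter_tiling :: "nat \<times> nat \<Rightarrow> nat" where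
  "parameter_tiling = (\<lambda>(x, y). if c x \<noteq> c y then 1 else 0)"

text \<open>A block is the list of its rows from top to bottom, each row listed from left to right.
  The first coordinate increases upwards and the second coordinate increases to the right, so
  the top row belongs to the first coordinate \<open>4 * x\<close>.\<close>

definition block_at :: "(nat \<times> nat \<Rightarrow> 'a) \<Rightarrow> nat \<times> nat \<Rightarrow> 'a list list" where
  "block_at T = (\<lambda>(x, y).
     map (\<lambda>u. map (\<lambda>v. T (u, v)) [4 * y - 3, 4 * y - 2, 4 * y - 1, 4 * y])
       [4 * x, 4 * x - 1, 4 * x - 2, 4 * x - 3])"

text \<open>The final \<open>[]\<close> is a dummy for cells outside the positive quadrant.\<close>

definition substitution :: "nat \<times> nat \<Rightarrow> nat list list" where
  "substitution p =
    (if p \<in> V \<times> V then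
       [[0, 1, 0, 0],
        [0, 1, 0, 0],
        [1, 0, 1, 1],
        [0, 1, 0, 0]]
     else if p \<in> V \<times> D then
       [[0, 1, 0, 1],
        [0, 1, 0, 1],
        [1, 0, 1, 0],
        [0, 1, 0, 1]]
     else if p \<in> D \<times> V then
       [[1, 0, 1, 1],
        [0, 1, 0, 0],
        [1, 0, 1, 1],
        [0, 1, 0, 0]]
     else if p \<in> D \<times> D then
       [[1, 0, 1, 0],
        [0, 1, 0, 1],
        [1, 0, 1, 0],
        [0, 1, 0, 1]]
     else [])"

text \<open>The block of a cell depends on the position of the cell through \<open>V\<close> and \<open>D\<close> and not only
  on its colour, so being a fixed point means that the \<open>4 \<times> 4\<close> block of the tiling that sits in
  the place of each cell is the block assigned to that cell.\<close>

definition is_fixed_point :: "(nat \<times> nat \<Rightarrow> 'a) \<Rightarrow> (nat \<times> nat \<Rightarrow> 'a list list) \<Rightarrow> bool" where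
  "is_fixed_point T \<sigma> \<longleftrightarrow> (\<forall>x > 0. \<forall>y > 0. block_at T (x, y) = \<sigma> (x, y))"

end

theory Submission imports Defs begin

text \<open>The last non-zero digit of a number that is not divisible by \<open>4\<close> is its units digit, and
  multiplying by \<open>4\<close> only appends a zero, so it does not change the last non-zero digit. Hence
  the sequence \<open>c\<close> is itself generated by a substitution of length \<open>4\<close>: on the four numbers
  \<open>4 * n - 3, 4 * n - 2, 4 * n - 1, 4 * n\<close> it takes the values \<open>1, 0, 1, c n\<close>
  (lemmas \<open>c_nondivisible\<close> and \<open>c_times_4\<close>). The colour of a cell compares two values of
  \<open>c\<close>, so the block in the place of \<open>(x, y)\<close> is the table that compares \<open>1, 0, 1, c x\<close> with
  \<open>1, 0, 1, c y\<close>; the four possible values of \<open>(c x, c y)\<close> give the four blocks of the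
  substitution.\<close>

lemma last_nonzero_digit4_nondivisible:
  assumes "n mod 4 \<noteq> 0"
  shows "last_nonzero_digit4 n = n mod 4"
proof -
  have "(LEAST i. digit4 n i \<noteq> 0) = 0"
    using assms by (intro Least_equality) (auto simp: digit4_def)
  then show ?thesis
    by (simp add: last_nonzero_digit4_def digit4_def)
qed

lemma digit4_times_4_Suc: "digit4 (4 * n) (Suc i) = digit4 n i"
  by (simp add: digit4_def)

lemma ex_nonzero_digit4:
  assumes "n > 0"
  shows "\<exists>i. digit4 n i \<noteq> 0"
  using assms
proof (induction n rule: less_induct)
  case (less n)
  show ?case
  proof (cases "n mod 4 = 0")
    case True
    then obtain m where m: "n = 4 * m" by auto
    with less.prems have "m < n" "m > 0" by simp_all
    then obtain i where "digit4 m i \<noteq> 0" using less.IH by blast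
    then have "digit4 n (Suc i) \<noteq> 0" by (simp add: m digit4_times_4_Suc)
    then show ?thesis ..
  next
    case False
    then have "digit4 n 0 \<noteq> 0" by (simp add: digit4_def)
    then show ?thesis ..
  qed
qed

text \<open>Positivity ensures that a non-zero digit exists, so that the least position of one moves
  up by exactly one when a zero is appended.\<close>

lemma last_nonzero_digit4_times_4:
  assumes "n > 0"
  shows "last_nonzero_digit4 (4 * n) = last_nonzero_digit4 n"
proof -
  obtain i where "digit4 n i \<noteq> 0" using ex_nonzero_digit4[OF assms] ..
  then have "digit4 (4 * n) (Suc i) \<noteq> 0" by (simp add: digit4_times_4_Suc)
  moreover have "\<not> digit4 (4 * n) 0 \<noteq> 0" by (simp add: digit4_def)
  ultimately have "(LEAST i. digit4 (4 * n) i \<noteq> 0) = Suc (LEAST i. digit4 (4 * n) (Suc i) \<noteq> 0)"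
    by (rule Least_Suc)
  then show ?thesis
    by (simp add: last_nonzero_digit4_def digit4_times_4_Suc)
qed

lemma c_times_4: "n > 0 \<Longrightarrow> c (4 * n) = c n"
  by (simp add: c_def V_def last_nonzero_digit4_times_4)

lemma c_nondivisible: "n mod 4 \<noteq> 0 \<Longrightarrow> c n = (if n mod 4 = 2 then 0 else 1)"
proof -
  assume n: "n mod 4 \<noteq> 0"
  have "n > 0" using n by (cases n) simp_all
  moreover have "n mod 4 = 1 \<or> n mod 4 = 2 \<or> n mod 4 = 3" using n by linarith
  ultimately show ?thesis
    unfolding c_def V_def mem_Collect_eq last_nonzero_digit4_nondivisible[OF n] by force
qed

lemma c_block:
  assumes "n > 0"
  shows "c (4 * n - 3) = 1" "c (4 * n - 2) = 0" "c (4 * n - 1) = 1" "c (4 * n) = c n"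
proof -
  obtain m where "n = Suc m" using assms gr0_implies_Suc by blast
  then have "4 * n - 3 = 4 * m + 1" "4 * n - 2 = 4 * m + 2" "4 * n - 1 = 4 * m + 3"
    by simp_all
  then have "(4 * n - 3) mod 4 = 1" "(4 * n - 2) mod 4 = 2" "(4 * n - 1) mod 4 = 3"
    by (simp_all only: mod_mult_self4) simp_all
  then show "c (4 * n - 3) = 1" "c (4 * n - 2) = 0" "c (4 * n - 1) = 1"
    by (simp_all add: c_nondivisible)
  show "c (4 * n) = c n" using assms by (rule c_times_4)
qed

theorem theorem4p8: "is_fixed_point parameter_tiling substitution"
  unfolding is_fixed_point_def
proof (intro allI impI)
  fix x y :: nat
  assume pos: "x > 0" "y > 0"
  show "block_at parameter_tiling (x, y) = substitution (x, y)"
    unfolding block_at_def parameter_tiling_def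
    (* the remaining values c x and c y are decided by membership in V *)
    using pos by (simp only: c_block list.map prod.case)
      (cases "x \<in> V"; cases "y \<in> V"; simp add: substitution_def D_def c_def)
qed

end
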